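(* Let $\lambda$ be the unique real root of $\lambda^3-\lambda^2-\lambda-1=0$. Let $x\in[0,1]$ have odd continued fraction representation $x=\left[1;\frac{\varepsilon_1}{a_1},\frac{\varepsilon_2}{a_2},\ldots\right]$ (finite if $x$ is rational, infinite if $x$ is irrational). Then the limit $F(x)=\lim_{n\to\infty}F_n(x)$ exists and $$F(x)=1-\sum_{i\ge 1}\frac{E_i}{\lambda^{A_i}},\qquad E_i=\prod_{j=1}^{i}(-\varepsilon_j),\qquad A_i=\sum_{j=1}^{i}a_j-1,$$ where the sum runs over all indices $i\geq 1$ of the representation (so it is a finite sum when $x$ is rational, and an infinite sum when $x$ is irrational).
   Context: Odd continued fraction representation: every $x\in[0,1]$ is written uniquely as $$x=\left[1;\frac{\varepsilon_1}{a_1},\frac{\varepsilon_2}{a_2},\ldots\right]=1+\cfrac{\varepsilon_1}{a_1+\cfrac{\varepsilon_2}{a_2+\cdots}},$$ finite (of some length $l\ge 0$) if $x$ is rational and infinite if $x$ is irrational, where all $a_i$ are odd positive integers, $\varepsilon_i\in\{1,-1\}$, $\varepsilon_1=-1$, and $a_j+\varepsilon_{j+1}\ge 2$ for all $j\ge1$ for which $\varepsilon_{j+1}$ occurs; moreover, in the finite case, if the last partial quotient is $a_l=1$ with $l\ge 2$, then $\varepsilon_l=1$. (The number $x=1$ has $l=0$; the number $x=0$ is $\left[1;\frac{-1}{1}\right]$.) For rational $x\in[0,1]$ with this representation put $S(x)=\sum_{j=1}^{l}a_j$. For $n\ge1$ let $\mathcal{M}_n=\{x\in\mathbb{Q}\cap[0,1]: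 S(x)\le n+1\}$, which is a finite set, and $$F_n(x)=\frac{\#\{\xi\in\mathcal{M}_n:\xi\le x\}}{\#\mathcal{M}_n},\qquad x\in[0,1].$$ *)

theory Defs
  imports Complex_Main "HOL-Library.Extended_Nat"
begin

text \<open>
  Digits are 1-based sequences \<open>e\<close> (signs) and \<open>a\<close> (partial quotients);
  a length \<open>l :: enat\<close> says which indices count, so values of \<open>e\<close> and \<open>a\<close> at \<open>0\<close> and
  beyond \<open>l\<close> are irrelevant.
\<close>

text \<open>\<open>cf_frac e a j m\<close> is \<open>e j / (a j + e (j+1) / (a (j+1) + ...))\<close> with \<open>m\<close> levels.\<close>

primrec cf_frac :: "(nat \<Rightarrow> int) \<Rightarrow> (nat \<Rightarrow> nat) \<Rightarrow> nat \<Rightarrow> nat \<Rightarrow> real" where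
  "cf_frac e a j 0 = 0"
| "cf_frac e a j (Suc m) = of_int (e j) / (real (a j) + cf_frac e a (Suc j) m)"

definition convergent_cf :: "(nat \<Rightarrow> int) \<Rightarrow> (nat \<Rightarrow> nat) \<Rightarrow> nat \<Rightarrow> real" where
  "convergent_cf e a k = 1 + cf_frac e a 1 k"

definition cf_has_value :: "enat \<Rightarrow> (nat \<Rightarrow> int) \<Rightarrow> (nat \<Rightarrow> nat) \<Rightarrow> real \<Rightarrow> bool" where
  "cf_has_value l e a x \<longleftrightarrow>
     (case l of enat k \<Rightarrow> x = convergent_cf e a k
              | \<infinity> \<Rightarrow> convergent_cf e a \<longlonglongrightarrow> x)"

text \<open>
  The digit conditions make every denominator occurring in \<^const>\<open>cf_frac\<close> at least \<open>1\<close>, so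
  division by zero never happens.
\<close>

definition odd_cf_digits :: "enat \<Rightarrow> (nat \<Rightarrow> int) \<Rightarrow> (nat \<Rightarrow> nat) \<Rightarrow> bool" where
  "odd_cf_digits l e a \<longleftrightarrow>
     (\<forall>i\<ge>1. enat i \<le> l \<longrightarrow> odd (a i) \<and> e i \<in> {1, -1}) \<and>
     (1 \<le> l \<longrightarrow> e 1 = -1) \<and>
     (\<forall>j\<ge>1. enat (j + 1) \<le> l \<longrightarrow> int (a j) + e (j + 1) \<ge> 2) \<and>
     (\<forall>k\<ge>2. l = enat k \<and> a k = 1 \<longrightarrow> e k = 1)"

definition odd_cf_rep :: "real \<Rightarrow> enat \<Rightarrow> (nat \<Rightarrow> int) \<Rightarrow> (nat \<Rightarrow> nat) \<Rightarrow> bool" where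
  "odd_cf_rep x l e a \<longleftrightarrow>
     odd_cf_digits l e a \<and> cf_has_value l e a x \<and> (x \<in> \<rat> \<longleftrightarrow> l \<noteq> \<infinity>)"

definition digit_sum :: "real \<Rightarrow> nat" where
  "digit_sum x = (THE s. \<exists>k e a. odd_cf_rep x (enat k) e a \<and> s = (\<Sum>j=1..k. a j))"

definition M :: "nat \<Rightarrow> real set" where
  "M n = {x \<in> \<rat> \<inter> {0..1}. digit_sum x \<le> n + 1}"

definition F_seq :: "nat \<Rightarrow> real \<Rightarrow> real" where
  "F_seq n x = real (card {\<xi> \<in> M n. \<xi> \<le> x}) / real (card (M n))"

definition lam :: real where
  "lam = (THE r. r ^ 3 - r ^ 2 - r - 1 = 0)"

definition E :: "(nat \<Rightarrow> int) \<Rightarrow> nat \<Rightarrow> int" where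
  "E e i = (\<Prod>j=1..i. - e j)"

text \<open>For \<open>i \<ge> 1\<close> the digit sum is positive, so the subtraction on \<^typ>\<open>nat\<close> does not truncate.\<close>

definition A :: "(nat \<Rightarrow> nat) \<Rightarrow> nat \<Rightarrow> nat" where
  "A a i = (\<Sum>j=1..i. a j) - 1"

end

theory Submission
  imports Defs
begin

text \<open>
  Write \<open>x = 1 - 1 / T\<close> with \<open>T = a\<^sub>1 + \<epsilon>\<^sub>2 / (a\<^sub>2 + \<dots>) \<ge> 1\<close>, and let \<open>W m\<close> be the number of rational \<open>t \<ge> 1\<close>
  of digit sum at most \<open>m\<close> and \<open>P m T\<close> the number of those exceeding \<open>T\<close>. Removing the first
  quotient gives \<open>P m (a + \<epsilon> / T') = W (m - a + 1) - \<epsilon> * P (m - a) T' + O(1)\<close>. Sorting \<open>t\<close> by the ranges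
  \<open>{1}\<close>, \<open>(1, 2]\<close>, \<open>(2, 3)\<close>, \<open>[3, \<infinity>)\<close> shows that \<open>W\<close> is a tribonacci sequence, so
  \<open>W (m - k) / W m\<close> tends to \<open>1 / lam ^ k\<close>; the proportions \<open>P m T / W m\<close> therefore converge to
  the signed series, the remainder after \<open>n\<close> digits being at most \<open>1 / lam ^ n\<close>.
\<close>

section \<open>The tribonacci constant\<close>

text \<open>Dividing out \<open>q - r\<close> leaves a quadratic in \<open>q\<close>. Completing the
  square bounds it below by \<open>1 / r - (r - 1) ^ 2 / 4\<close>, which exceeds
  \<open>1 / 2 - 1 / 4\<close>, so it has no real zero.\<close>

lemma cubic_unique_root:
  fixes r q :: real
  assumes r: "r ^ 3 - r ^ 2 - r - 1 = 0" "1 < r" "r < 2" and q: "q ^ 3 - q ^ 2 - q - 1 = 0"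
  shows "q = r"
proof (rule ccontr)
  assume "q \<noteq> r"
  have "(q - r) * (q ^ 2 + (r - 1) * q + (r ^ 2 - r - 1)) = 0"
    using r(1) q by (simp add: algebra_simps power2_eq_square power3_eq_cube)
  with \<open>q \<noteq> r\<close> have "q ^ 2 + (r - 1) * q + (r ^ 2 - r - 1) = 0" by simp
  moreover have "q ^ 2 + (r - 1) * q + (r ^ 2 - r - 1)
      = (q + (r - 1) / 2) ^ 2 + ((r ^ 2 - r - 1) - (r - 1) ^ 2 / 4)"
    by (simp add: field_simps power2_eq_square)
  moreover have "r ^ 2 - r - 1 = 1 / r"
    using r by (simp add: field_simps power2_eq_square power3_eq_cube)
  moreover have "1 / r > 1 / 2" using r by (simp add: field_simps)
  moreover have "(r - 1) ^ 2 \<le> 1" using r by (simp add: power_le_one)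
  moreover have "(q + (r - 1) / 2) ^ 2 \<ge> 0" by simp
  ultimately show False by linarith
qed

lemma lam_root: "lam ^ 3 - lam ^ 2 - lam - 1 = 0"
  and lam_bounds: "1 < lam" "lam < 2"
proof -
  \<comment> \<open>The cubic is negative at \<open>3/2\<close> and equals 1 at 2.\<close>
  have "\<exists>r\<ge>3/2. r \<le> 2 \<and> r ^ 3 - r ^ 2 - r - 1 = (0::real)"
    by (rule IVT) (auto simp: power2_eq_square power3_eq_cube)
  then obtain r :: real where r: "3/2 \<le> r" "r \<le> 2" "r ^ 3 - r ^ 2 - r - 1 = 0" by blast
  have "r \<noteq> 2" using r(3) by auto
  with r have r2: "1 < r" "r < 2" by auto
  have "lam = r"
    unfolding lam_def using r(3) cubic_unique_root[OF r(3) r2] by (rule the_equality)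
  with r r2 show "lam ^ 3 - lam ^ 2 - lam - 1 = 0" "1 < lam" "lam < 2" by auto
qed

text \<open>
  The deviation \<open>u (n + 1) - lam * u n\<close> obeys the recurrence of the two complex roots, whose
  characteristic polynomial \<open>z\<^sup>2 + (lam - 1) z + 1 / lam\<close> has negative discriminant; the associated
  definite quadratic form is multiplied by \<open>1 / lam\<close> in every step, so the deviation is bounded.
\<close>

lemma tribonacci_deviation_bounded:
  fixes u :: "nat \<Rightarrow> real"
  assumes rec: "\<And>n. u (n + 3) = u (n + 2) + u (n + 1) + u n"
  shows "\<exists>K. \<forall>n. \<bar>u (Suc n) - lam * u n\<bar> \<le> K"
proof -
  define b where "b = lam - 1"
  define c where "c = 1 / lam"
  define d where "d n = u (Suc n) - lam * u n" for n
  define Q where "Q n = d (Suc n) ^ 2 + b * d (Suc n) * d n + c * d n ^ 2" for n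
  have c_eq: "c = lam ^ 2 - lam - 1"
    unfolding c_def using lam_root lam_bounds
    by (simp add: field_simps power2_eq_square power3_eq_cube)
  have c: "1 / 2 < c" "c < 1" using lam_bounds by (auto simp: c_def field_simps)
  have b: "b ^ 2 \<le> 1" using lam_bounds by (simp add: b_def power_le_one)
  have drec: "d (Suc (Suc n)) = - b * d (Suc n) - c * d n" for n
  proof -
    have "lam * (lam ^ 2 - lam - 1) = 1"
      using lam_root by (simp add: algebra_simps power2_eq_square power3_eq_cube)
    then have "lam * (lam ^ 2 - lam - 1) * u n = u n" by simp
    then show ?thesis
      using rec[of n]
      by (simp add: d_def b_def c_eq algebra_simps power2_eq_square numeral_3_eq_3)
  qed
  have Qrec: "Q (Suc n) = c * Q n" for n
    unfolding Q_def drec by (simp add: algebra_simps power2_eq_square)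
  have Q_lower: "d n ^ 2 / 4 \<le> Q n" for n
  proof -
    have "Q n = (d (Suc n) + b / 2 * d n) ^ 2 + (c - b ^ 2 / 4) * d n ^ 2"
      by (simp add: Q_def field_simps power2_eq_square)
    \<comment> \<open>The coefficient \<open>c - b ^ 2 / 4\<close> exceeds \<open>1 / 4\<close>
      because \<open>c > 1 / 2\<close> and \<open>b ^ 2\<close> is at most 1.\<close>
    moreover have "1 / 4 * d n ^ 2 \<le> (c - b ^ 2 / 4) * d n ^ 2"
      using b c by (intro mult_right_mono) auto
    moreover have "0 \<le> (d (Suc n) + b / 2 * d n) ^ 2" by simp
    ultimately show ?thesis by linarith
  qed
  have Q_upper: "Q n \<le> Q 0" for n
  proof (induction n)
    case (Suc n)
    have "0 \<le> Q n" using Q_lower[of n] by (smt (verit) divide_nonneg_nonneg zero_le_power2)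
    then have "c * Q n \<le> Q n" using c by (simp add: mult_left_le_one_le)
    with Suc Qrec show ?case by simp
  qed simp
  have "\<bar>d n\<bar> \<le> 1 + 4 * Q 0" for n
  proof -
    have "d n ^ 2 \<le> 4 * Q 0" using Q_lower[of n] Q_upper[of n] by linarith
    \<comment> \<open>A crude bound that turns control of the square into control of
      \<open>d n\<close> without square roots.\<close>
    moreover have "\<bar>d n\<bar> \<le> 1 + d n ^ 2"
      using zero_le_power2[of "\<bar>d n\<bar> - 1"] by (simp add: power2_diff)
    ultimately show ?thesis by linarith
  qed
  then show ?thesis unfolding d_def by blast
qed

text \<open>The deviation is bounded while \<open>u n\<close> tends to infinity, so after division
  by \<open>u n\<close> it vanishes in the limit.\<close>

lemma tribonacci_ratio_limit:
  fixes u :: "nat \<Rightarrow> real"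
  assumes rec: "\<And>n. u (n + 3) = u (n + 2) + u (n + 1) + u n"
    and pos: "\<And>n. u n > 0" and lim: "filterlim u at_top sequentially"
  shows "(\<lambda>n. u n / u (Suc n)) \<longlonglongrightarrow> 1 / lam"
proof -
  obtain K where K: "\<And>n. \<bar>u (Suc n) - lam * u n\<bar> \<le> K"
    using tribonacci_deviation_bounded[OF rec] by blast
  have "(\<lambda>n. (u (Suc n) - lam * u n) / u n) \<longlonglongrightarrow> 0"
  proof (rule tendsto_0_le)
    show "(\<lambda>n. K / u n) \<longlonglongrightarrow> 0"
      by (rule tendsto_divide_0[OF tendsto_const filterlim_at_top_imp_at_infinity[OF lim]])
    have "0 \<le> K" using K[of 0] by linarith
    then show "\<forall>\<^sub>F n in sequentially. norm ((u (Suc n) - lam * u n) / u n) \<le> norm (K / u n) * 1"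
      using K pos by (intro always_eventually) (simp add: abs_of_pos divide_right_mono less_imp_le)
  qed
  then have "(\<lambda>n. lam + (u (Suc n) - lam * u n) / u n) \<longlonglongrightarrow> lam + 0"
    by (intro tendsto_intros)
  moreover have "lam + (u (Suc n) - lam * u n) / u n = u (Suc n) / u n" for n
    using pos[of n] by (simp add: field_simps)
  ultimately have "(\<lambda>n. u (Suc n) / u n) \<longlonglongrightarrow> lam" by simp
  then have "(\<lambda>n. 1 / (u (Suc n) / u n)) \<longlonglongrightarrow> 1 / lam"
    using lam_bounds by (intro tendsto_intros) auto
  then show ?thesis by simp
qed

section \<open>Rational tails and their digit sums\<close>

text \<open>
  \<open>tail t s\<close>: the rational \<open>t \<ge> 1\<close> has an expansion \<open>a\<^sub>1 + \<epsilon>\<^sub>2 / (a\<^sub>2 + \<dots>)\<close> with digit sum \<open>s\<close>. The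
  leading odd quotient is built up in steps of two, so that the four rules produce values in the
  disjoint ranges \<open>{1}\<close>, \<open>(1, 2]\<close>, \<open>(2, 3)\<close>, \<open>[3, \<infinity>)\<close>.
\<close>

inductive tail :: "real \<Rightarrow> nat \<Rightarrow> bool" where
  tail_one: "tail 1 1"
| tail_plus: "tail t s \<Longrightarrow> tail (1 + 1 / t) (s + 1)"
| tail_minus: "tail t s \<Longrightarrow> t \<noteq> 1 \<Longrightarrow> tail (3 - 1 / t) (s + 3)"
| tail_shift: "tail t s \<Longrightarrow> tail (t + 2) (s + 2)"

lemma tail_ge_1: "tail t s \<Longrightarrow> 1 \<le> t \<and> 1 \<le> s"
  by (induction rule: tail.induct) (auto simp: field_simps)

lemma tail_Rats: "tail t s \<Longrightarrow> t \<in> \<rat>"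
  by (induction rule: tail.induct) auto

text \<open>For \<open>t = 1\<close> the value would be 2, which \<open>tail_plus\<close> already
  produces; excluding it keeps the ranges disjoint.\<close>

lemma tail_minus_bounds: "tail t s \<Longrightarrow> t \<noteq> 1 \<Longrightarrow> 2 < 3 - 1 / t \<and> 3 - 1 / t < 3"
  using tail_ge_1[of t s] by (auto simp: field_simps)

lemma tail_plus_bounds: "tail t s \<Longrightarrow> 1 < 1 + 1 / t \<and> 1 + 1 / t \<le> 2"
  using tail_ge_1[of t s] by (auto simp: field_simps)

text \<open>Inversion by size: the four rules have disjoint ranges, so the value of \<open>t\<close>
  reveals the rule applied last. The next three lemmas treat the other ranges.\<close>

lemma tail_one_D:
  assumes "tail t s" "t = 1" shows "s = 1"
  using assms(1)
proof cases
  case tail_one then show ?thesis by simp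
next
  case (tail_plus t') then show ?thesis using assms(2) tail_plus_bounds[of t'] by force
next
  case (tail_minus t') then show ?thesis using assms(2) tail_minus_bounds[of t'] by force
next
  case (tail_shift t') then show ?thesis using assms(2) tail_ge_1[of t'] by force
qed

lemma tail_plus_D:
  assumes "tail t s" "1 < t" "t \<le> 2" shows "\<exists>t' s'. t = 1 + 1 / t' \<and> s = s' + 1 \<and> tail t' s'"
  using assms(1)
proof cases
  case tail_one then show ?thesis using assms by simp
next
  case (tail_plus t') then show ?thesis by blast
next
  case (tail_minus t') then show ?thesis using assms tail_minus_bounds[of t'] by force
next
  case (tail_shift t') then show ?thesis using assms tail_ge_1[of t'] by force
qed

lemma tail_minus_D:
  assumes "tail t s" "2 < t" "t < 3"
  shows "\<exists>t' s'. t = 3 - 1 / t' \<and> s = s' + 3 \<and> tail t' s' \<and> t' \<noteq> 1"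
  using assms(1)
proof cases
  case tail_one then show ?thesis using assms by simp
next
  case (tail_plus t') then show ?thesis using assms tail_plus_bounds[of t'] by force
next
  case (tail_minus t') then show ?thesis by blast
next
  case (tail_shift t') then show ?thesis using assms tail_ge_1[of t'] by force
qed

lemma tail_shift_D:
  assumes "tail t s" "3 \<le> t" shows "\<exists>t' s'. t = t' + 2 \<and> s = s' + 2 \<and> tail t' s'"
  using assms(1)
proof cases
  case tail_one then show ?thesis using assms by simp
next
  case (tail_plus t') then show ?thesis using assms tail_plus_bounds[of t'] by force
next
  case (tail_minus t') then show ?thesis using assms tail_minus_bounds[of t'] by force
next
  case (tail_shift t') then show ?thesis by blast
qed

text \<open>The range of the value forces both derivations to end with the same rule, and each rule
  is injective in its argument.\<close>

lemma tail_unique: "tail t s \<Longrightarrow> tail t s' \<Longrightarrow> s = s'"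
proof (induction arbitrary: s' rule: tail.induct)
  case tail_one then show ?case using tail_one_D by simp
next
  case (tail_plus t s)
  then show ?case
    using tail_plus_D[of "1 + 1 / t" s'] tail_plus_bounds[of t s] by fastforce
next
  case (tail_minus t s)
  then show ?case
    using tail_minus_D[of "3 - 1 / t" s'] tail_minus_bounds[of t s] by fastforce
next
  case (tail_shift t s)
  have "3 \<le> t + 2" using tail_ge_1[OF tail_shift.hyps] by simp
  with tail_shift_D[OF tail_shift.prems] obtain t' s''
    where "t + 2 = t' + 2" "s' = s'' + 2" "tail t' s''" by blast
  with tail_shift.IH show ?case by simp
qed

text \<open>A Euclidean algorithm: the four cases match the ranges of the rules, and each case
  except \<open>p = q\<close> passes to a pair with a smaller sum \<open>p + q\<close>.\<close>

lemma tail_exists_quotient: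
  fixes p q :: nat
  assumes "1 \<le> q" "q \<le> p"
  shows "\<exists>s. tail (real p / real q) s"
  using assms
proof (induction "p + q" arbitrary: p q rule: less_induct)
  case less
  consider "p = q" | "q < p" "p \<le> 2 * q" | "2 * q < p" "p < 3 * q" | "3 * q \<le> p"
    using less.prems by linarith
  then show ?case
  proof cases
    case 1
    then show ?thesis using less.prems tail_one by auto
  next
    case 2
    have "\<exists>s. tail (real q / real (p - q)) s"
      using less.prems 2 by (intro less.hyps) auto
    moreover have "real p / real q = 1 + 1 / (real q / real (p - q))"
      using 2 less.prems by (simp add: field_simps of_nat_diff)
    ultimately show ?thesis using tail_plus by metis
  next
    case 3
    have "\<exists>s. tail (real q / real (3 * q - p)) s"
      using less.prems 3 by (intro less.hyps) auto
    moreover have "real p / real q = 3 - 1 / (real q / real (3 * q - p))"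
      using 3 less.prems by (simp add: field_simps of_nat_diff)
    moreover have "real q / real (3 * q - p) \<noteq> 1"
      using 3 by (auto simp: field_simps of_nat_diff)
    ultimately show ?thesis using tail_minus by metis
  next
    case 4
    have "\<exists>s. tail (real (p - 2 * q) / real q) s"
      using less.prems 4 by (intro less.hyps) auto
    moreover have "real p / real q = real (p - 2 * q) / real q + 2"
      using 4 less.prems by (simp add: field_simps of_nat_diff)
    ultimately show ?thesis using tail_shift by metis
  qed
qed

lemma tail_exists:
  assumes "t \<in> \<rat>" "1 \<le> t"
  shows "\<exists>s. tail t s"
proof -
  obtain p q :: nat where "q \<noteq> 0" "\<bar>t\<bar> = real p / real q"
    using Rats_abs_nat_div_natE[OF assms(1)] by metis
  moreover from this assms(2) have "q \<le> p" by (simp add: le_divide_eq split: if_splits)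
  ultimately show ?thesis
    using tail_exists_quotient[of q p] assms(2) by simp
qed

lemma tail_shift_even: "tail t s \<Longrightarrow> tail (t + 2 * real k) (s + 2 * k)"
proof (induction k)
  case (Suc k)
  then show ?case using tail_shift[of "t + 2 * real k" "s + 2 * k"] by (simp add: algebra_simps)
qed simp

lemma tail_odd:
  assumes "odd a" shows "tail (real a) a"
proof -
  obtain k where "a = 2 * k + 1" using assms by (elim oddE)
  then show ?thesis using tail_shift_even[OF tail_one, of k] by (simp add: algebra_simps)
qed

text \<open>A full continued fraction step is the rule for quotient 1 (sign 1) or quotient 3 (sign
  -1), followed by shifts by two.\<close>

lemma tail_step:
  fixes e :: int
  assumes "odd a" "e \<in> {1, -1}" "int a + e \<ge> 2" "tail t s" "e = -1 \<Longrightarrow> t \<noteq> 1"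
  shows "tail (real a + of_int e / t) (a + s)"
proof (cases "e = 1")
  case True
  obtain k where "a = 2 * k + 1" using assms(1) by (elim oddE)
  then show ?thesis
    using tail_shift_even[OF tail_plus[OF assms(4)], of k] True by (simp add: algebra_simps)
next
  case False
  with assms have e: "e = -1" by auto
  obtain k where k: "a = 2 * k + 1" using assms(1) by (elim oddE)
  \<comment> \<open>With sign -1 the digit condition excludes \<open>a = 1\<close>, so at least one
    pair of units can be split off.\<close>
  with e assms(3) obtain k' where "k = Suc k'" by (cases k) auto
  then show ?thesis
    using tail_shift_even[OF tail_minus[OF assms(4) assms(5)[OF e]], of k'] e k
    by (simp add: algebra_simps numeral_3_eq_3)
qed

section \<open>Digit sequences\<close>

lemma odd_cf_digitsD:
  assumes "odd_cf_digits l e a" "1 \<le> i" "enat i \<le> l"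
  shows "odd (a i)" "e i \<in> {1, -1}" "1 \<le> a i"
proof -
  show "odd (a i)" "e i \<in> {1, -1}" using assms unfolding odd_cf_digits_def by auto
  then show "1 \<le> a i" by (cases "a i") auto
qed

lemma odd_cf_digits_stepD:
  assumes "odd_cf_digits l e a" "1 \<le> i" "enat (Suc i) \<le> l"
  shows "2 \<le> int (a i) + e (Suc i)"
  using assms unfolding odd_cf_digits_def by auto

lemma odd_cf_digits_firstD: "odd_cf_digits l e a \<Longrightarrow> 1 \<le> l \<Longrightarrow> e 1 = -1"
  unfolding odd_cf_digits_def by auto

lemma odd_cf_digits_lastD: "odd_cf_digits (enat k) e a \<Longrightarrow> 2 \<le> k \<Longrightarrow> a k = 1 \<Longrightarrow> e k = 1"
  unfolding odd_cf_digits_def by auto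

lemma step_gt_1:
  fixes e :: int and t :: real
  assumes "1 \<le> a" "e \<in> {1, -1}" "int a + e \<ge> 2" "1 \<le> t" "odd a"
  shows "1 < real a + of_int e / t"
proof (cases "e = 1")
  case True
  moreover have "0 < 1 / t" using assms(4) by simp
  moreover have "1 \<le> real a" using assms(1) by simp
  ultimately have "1 < real a + 1 / t" by linarith
  with True show ?thesis by simp
next
  case False
  with assms have "e = -1" "a \<ge> 3" by auto
  moreover have "1 / t \<le> 1" using assms by simp
  ultimately show ?thesis by (simp add: less_diff_eq)
qed

text \<open>The second conjunct strengthens the induction: it supplies the side condition
  \<open>t \<noteq> 1\<close> whenever a quotient is joined with sign -1.\<close>

lemma tail_of_digits:
  assumes "odd_cf_digits (enat (j + m)) e a" "1 \<le> j"
  shows "tail (real (a j) + cf_frac e a (Suc j) m) (\<Sum>i=j..j+m. a i)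
    \<and> (real (a j) + cf_frac e a (Suc j) m = 1 \<longrightarrow> m = 0 \<and> a j = 1)"
  using assms
proof (induction m arbitrary: j)
  case 0
  then show ?case using odd_cf_digitsD[OF 0(1), of j] tail_odd by auto
next
  case (Suc m)
  let ?t = "real (a (Suc j)) + cf_frac e a (Suc (Suc j)) m"
  have dig: "odd_cf_digits (enat (Suc j + m)) e a" using Suc.prems by simp
  from Suc.IH[OF dig] have t: "tail ?t (\<Sum>i=Suc j..Suc j+m. a i)"
    and t1: "?t = 1 \<Longrightarrow> m = 0 \<and> a (Suc j) = 1" by auto
  have aj: "odd (a j)" "1 \<le> a j" using odd_cf_digitsD[OF Suc.prems(1), of j] Suc.prems by auto
  have ej: "e (Suc j) \<in> {1, -1}" using odd_cf_digitsD(2)[OF Suc.prems(1), of "Suc j"] by auto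
  have st: "2 \<le> int (a j) + e (Suc j)"
    using odd_cf_digits_stepD[OF Suc.prems(1), of j] Suc.prems by auto
  \<comment> \<open>Value 1 would mean that the last quotient is 1 with sign -1, which the digit
    conditions forbid.\<close>
  have ne: "?t \<noteq> 1" if "e (Suc j) = -1"
  proof
    assume "?t = 1"
    with t1 have "m = 0" "a (Suc j) = 1" by auto
    with dig odd_cf_digits_lastD[of "Suc j" e a] Suc.prems(2) that show False by auto
  qed
  have "1 \<le> ?t" using tail_ge_1[OF t] by simp
  then have gt: "1 < real (a j) + of_int (e (Suc j)) / ?t" using step_gt_1 aj ej st by blast
  have "(\<Sum>i=j..j + Suc m. a i) = a j + (\<Sum>i=Suc j..Suc j+m. a i)"
    by (subst sum.atLeast_Suc_atMost) auto
  with tail_step[OF aj(1) ej st t ne] gt show ?case by (simp del: sum.cl_ivl_Suc)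
qed

text \<open>Used with \<open>d = 1\<close> when a digit is prepended, and with \<open>d = 0\<close>
  when a digit before index \<open>j\<close> is altered.\<close>

lemma cf_frac_reindex:
  assumes "\<And>i. j \<le> i \<Longrightarrow> e' (i + d) = e i \<and> a' (i + d) = a i"
  shows "cf_frac e' a' (j + d) m = cf_frac e a j m"
  using assms
proof (induction m arbitrary: j)
  case (Suc m)
  then show ?case using Suc.IH[of "Suc j"] Suc.prems[of j] by simp
qed simp

text \<open>Here \<open>t\<close> is the denominator in \<open>x = 1 - 1 / t\<close>; the leading
  sign -1 required by \<open>odd_cf_digits\<close> stays outside \<open>t\<close>.\<close>

definition has_digits :: "real \<Rightarrow> nat \<Rightarrow> bool" where
  "has_digits t s \<longleftrightarrow> (\<exists>m e a. odd_cf_digits (enat (Suc m)) e a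
     \<and> t = real (a 1) + cf_frac e a 2 m \<and> s = (\<Sum>j=1..Suc m. a j))"

lemma has_digits_prepend:
  assumes "has_digits t s" and b: "odd b" and f: "f \<in> {1, -1}" "2 \<le> int b + f"
    and ne1: "f = -1 \<Longrightarrow> t \<noteq> 1"
  shows "has_digits (real b + of_int f / t) (b + s)"
proof -
  obtain m e a where dig: "odd_cf_digits (enat (Suc m)) e a"
    and t: "t = real (a 1) + cf_frac e a 2 m" and s: "s = (\<Sum>j=1..Suc m. a j)"
    using assms(1) unfolding has_digits_def by blast
  have ne: "f = -1 \<Longrightarrow> real (a 1) + cf_frac e a 2 m \<noteq> 1" using ne1 t by simp
  show ?thesis
    unfolding has_digits_def t s
  proof (intro exI conjI)
    \<comment> \<open>The new sign \<open>f\<close> stands between \<open>b\<close> and the old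
      first quotient, hence at index 2; index 1 keeps the mandatory -1.\<close>
    let ?e = "\<lambda>i. if i = 1 then -1 else if i = 2 then f else e (i - 1)"
    let ?a = "\<lambda>i. if i = 1 then b else a (i - 1)"
    have cf: "cf_frac ?e ?a 3 m = cf_frac e a 2 m"
      using cf_frac_reindex[of 2 ?e 1 e ?a a m] by (simp add: numeral_3_eq_3)
    show "real b + of_int f / (real (a 1) + cf_frac e a 2 m) = real (?a 1) + cf_frac ?e ?a 2 (Suc m)"
      using cf by (simp add: numeral_2_eq_2 numeral_3_eq_3)
    have "(\<Sum>j=1..Suc (Suc m). ?a j) = b + (\<Sum>j=Suc 1..Suc (Suc m). ?a j)"
      by (subst sum.atLeast_Suc_atMost) auto
    also have "(\<Sum>j=Suc 1..Suc (Suc m). ?a j) = (\<Sum>j=1..Suc m. a j)"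
      by (subst sum.shift_bounds_cl_Suc_ivl) (auto intro!: sum.cong)
    finally show "b + (\<Sum>j=1..Suc m. a j) = (\<Sum>j=1..Suc (Suc m). ?a j)" ..
    show "odd_cf_digits (enat (Suc (Suc m))) ?e ?a"
      unfolding odd_cf_digits_def
    proof (intro conjI allI impI)
      fix i assume i: "1 \<le> i" "enat i \<le> enat (Suc (Suc m))"
      show "odd (?a i)" using b odd_cf_digitsD[OF dig, of "i - 1"] i by (cases "i = 1") auto
      show "?e i \<in> {1, -1}" using f odd_cf_digitsD(2)[OF dig, of "i - 1"] i by auto
    next
      fix j assume j: "1 \<le> j" "enat (j + 1) \<le> enat (Suc (Suc m))"
      show "2 \<le> int (?a j) + ?e (j + 1)"
        using f odd_cf_digits_stepD[OF dig, of "j - 1"] j by (cases "j = 1") auto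
    next
      fix k assume k: "2 \<le> k" "enat (Suc (Suc m)) = enat k \<and> ?a k = 1"
      show "?e k = 1"
      proof (cases "k = 2")
        case True
        \<comment> \<open>The old expansion is then the single quotient 1, so \<open>t = 1\<close>
          and the side condition leaves only \<open>f = 1\<close>.\<close>
        with k have "m = 0" "a 1 = 1" by auto
        with ne f True show ?thesis by auto
      next
        case False
        with k have "a (Suc m) = 1" "2 \<le> Suc m" by auto
        with odd_cf_digits_lastD[OF dig] k False show ?thesis by auto
      qed
    qed simp
  qed
qed

text \<open>Converse of \<open>tail_of_digits\<close>: \<open>tail_plus\<close> and
  \<open>tail_minus\<close> prepend a quotient 1 or 3, while \<open>tail_shift\<close> raises the
  first quotient by 2.\<close>

lemma digits_of_tail: "tail t s \<Longrightarrow> has_digits t s"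
proof (induction rule: tail.induct)
  case tail_one
  have "odd_cf_digits (enat (Suc 0)) (\<lambda>_. -1) (\<lambda>_. 1)" by (auto simp: odd_cf_digits_def)
  then show ?case
    unfolding has_digits_def
    by (intro exI[of _ 0] exI[of _ "\<lambda>_. -1"] exI[of _ "\<lambda>_. 1"]) simp
next
  case (tail_plus t s)
  then show ?case using has_digits_prepend[of t s 1 1] by (simp add: add.commute)
next
  case (tail_minus t s)
  then show ?case using has_digits_prepend[of t s 3 "-1"] by (simp add: add.commute)
next
  case (tail_shift t s)
  then obtain m e a where *: "odd_cf_digits (enat (Suc m)) e a" "t = real (a 1) + cf_frac e a 2 m"
    "s = (\<Sum>j=1..Suc m. a j)" unfolding has_digits_def by blast
  define a' where "a' = (\<lambda>i. if i = 1 then a 1 + 2 else a i)"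
  have "odd_cf_digits (enat (Suc m)) e a'"
    using *(1) unfolding odd_cf_digits_def a'_def by auto
  moreover have "cf_frac e a' 2 m = cf_frac e a 2 m"
    using cf_frac_reindex[of 2 e 0 e a' a m] by (simp add: a'_def)
  moreover have "(\<Sum>j=1..Suc m. a' j) = (\<Sum>j=1..Suc m. a j) + 2"
  proof -
    have "(\<Sum>j=Suc 1..Suc m. a' j) = (\<Sum>j=Suc 1..Suc m. a j)"
      by (intro sum.cong) (auto simp: a'_def)
    then show ?thesis
      using sum.atLeast_Suc_atMost[of 1 "Suc m" a'] sum.atLeast_Suc_atMost[of 1 "Suc m" a]
      by (simp add: a'_def del: sum.cl_ivl_Suc)
  qed
  moreover have "a' 1 = a 1 + 2" by (simp add: a'_def)
  ultimately show ?case
    unfolding has_digits_def using *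
    by (intro exI[of _ m] exI[of _ e] exI[of _ a']) (simp del: sum.cl_ivl_Suc)
qed

lemma convergent_cf_Suc:
  assumes "odd_cf_digits l e a" "1 \<le> l"
  shows "convergent_cf e a (Suc m) = 1 - 1 / (real (a 1) + cf_frac e a 2 m)"
  using odd_cf_digits_firstD[OF assms] by (simp add: convergent_cf_def numeral_2_eq_2)

text \<open>Rewrites the description inside \<open>digit_sum\<close> in terms of
  \<open>tail\<close>, for which uniqueness is known. The value \<open>x = 1\<close> is the
  expansion of length 0.\<close>

lemma odd_cf_rep_enat_iff:
  "(\<exists>k e a. odd_cf_rep x (enat k) e a \<and> s = (\<Sum>j=1..k. a j))
    \<longleftrightarrow> (x = 1 \<and> s = 0) \<or> (\<exists>t. x = 1 - 1 / t \<and> tail t s)"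
  (is "?L \<longleftrightarrow> ?R")
proof
  assume ?L
  then obtain k e a where r: "odd_cf_digits (enat k) e a" "x = convergent_cf e a k"
    and s: "s = (\<Sum>j=1..k. a j)" by (auto simp: odd_cf_rep_def cf_has_value_def)
  show ?R
  proof (cases k)
    case 0 then show ?thesis using r s by (simp add: convergent_cf_def)
  next
    case (Suc m)
    then show ?thesis
      using r s tail_of_digits[of 1 m e a] convergent_cf_Suc[OF r(1), of m]
      by (auto simp: one_enat_def numeral_2_eq_2)
  qed
next
  assume ?R
  then show ?L
  proof (elim disjE conjE exE)
    assume "x = 1" "s = 0"
    then have "odd_cf_rep x (enat 0) (\<lambda>_. 1) (\<lambda>_. 1) \<and> s = (\<Sum>j=1..0::nat. 1)"
      by (auto simp: odd_cf_rep_def odd_cf_digits_def cf_has_value_def convergent_cf_def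
          one_enat_def)
    then show ?L by blast
  next
    fix t assume t: "x = 1 - 1 / t" "tail t s"
    obtain m e a where *: "odd_cf_digits (enat (Suc m)) e a" "t = real (a 1) + cf_frac e a 2 m"
      "s = (\<Sum>j=1..Suc m. a j)" using digits_of_tail[OF t(2)] unfolding has_digits_def by blast
    have "x \<in> \<rat>" using t tail_Rats by auto
    with * t convergent_cf_Suc[OF *(1), of m]
    have "odd_cf_rep x (enat (Suc m)) e a"
      by (simp add: odd_cf_rep_def cf_has_value_def one_enat_def)
    with *(3) show ?L by blast
  qed
qed

text \<open>Since \<open>1 / 0 = 0\<close>, the equation \<open>1 = 1 - 1 / t\<close> holds at
  \<open>t = 0\<close>; the bound from \<open>tail_ge_1\<close> rules this out.\<close>

lemma digit_sum_1: "digit_sum 1 = 0"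
  unfolding digit_sum_def odd_cf_rep_enat_iff
  by (rule the_equality) (use tail_ge_1 in force)+

lemma digit_sum_tail:
  assumes "tail t s" shows "digit_sum (1 - 1 / t) = s"
  unfolding digit_sum_def odd_cf_rep_enat_iff
proof (rule the_equality)
  fix s' assume "(1 - 1 / t = 1 \<and> s' = 0) \<or> (\<exists>t'. 1 - 1 / t = 1 - 1 / t' \<and> tail t' s')"
  then show "s' = s" using tail_unique[OF assms] tail_ge_1[OF assms] by auto
qed (use assms in blast)

section \<open>Counting tails\<close>

definition tails_upto :: "nat \<Rightarrow> real set" where
  "tails_upto m = {t. \<exists>s\<le>m. tail t s}"

definition num_tails :: "nat \<Rightarrow> nat" where
  "num_tails m = card (tails_upto m)"

definition num_above :: "nat \<Rightarrow> real \<Rightarrow> nat" where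
  "num_above m T = card {t \<in> tails_upto m. T < t}"

lemma tails_upto_ge_1: "t \<in> tails_upto m \<Longrightarrow> 1 \<le> t"
  using tail_ge_1 by (auto simp: tails_upto_def)

lemma tails_upto_0: "tails_upto 0 = {}"
  using tail_ge_1[of _ 0] by (auto simp: tails_upto_def)

lemma one_in_tails_upto: "1 \<in> tails_upto m \<longleftrightarrow> 1 \<le> m"
proof
  assume "1 \<in> tails_upto m"
  then obtain s where "s \<le> m" "tail 1 s" by (auto simp: tails_upto_def)
  with tail_one_D[of 1 s] show "1 \<le> m" by simp
next
  assume "1 \<le> m"
  with tail_one show "1 \<in> tails_upto m" unfolding tails_upto_def by blast
qed

text \<open>Truncated subtraction is harmless here and in the next two lemmas: digit sums are
  positive, so \<open>tails_upto 0\<close> is empty.\<close>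

lemma tails_upto_plus: "tails_upto m \<inter> {1<..2} = (\<lambda>t. 1 + 1 / t) ` tails_upto (m - 1)"
proof (intro equalityI subsetI)
  fix t assume t: "t \<in> tails_upto m \<inter> {1<..2}"
  then obtain s where s: "tail t s" "s \<le> m" by (auto simp: tails_upto_def)
  with t obtain t' s' where "t = 1 + 1 / t'" "s = s' + 1" "tail t' s'"
    using tail_plus_D[of t s] by auto
  with s show "t \<in> (\<lambda>t. 1 + 1 / t) ` tails_upto (m - 1)"
    by (auto simp: tails_upto_def intro!: image_eqI[of _ _ t'] exI[of _ s'])
next
  fix t assume "t \<in> (\<lambda>t. 1 + 1 / t) ` tails_upto (m - 1)"
  then obtain t' s' where t': "t = 1 + 1 / t'" "tail t' s'" "s' \<le> m - 1"
    by (auto simp: tails_upto_def)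
  with tail_ge_1[OF t'(2)] have "s' + 1 \<le> m" by auto
  with t' show "t \<in> tails_upto m \<inter> {1<..2}"
    using tail_plus[OF t'(2)] tail_plus_bounds[OF t'(2)] by (auto simp: tails_upto_def)
qed

lemma tails_upto_minus:
  "tails_upto m \<inter> {2<..<3} = (\<lambda>t. 3 - 1 / t) ` (tails_upto (m - 3) - {1})"
proof (intro equalityI subsetI)
  fix t assume t: "t \<in> tails_upto m \<inter> {2<..<3}"
  then obtain s where s: "tail t s" "s \<le> m" by (auto simp: tails_upto_def)
  with t obtain t' s' where "t = 3 - 1 / t'" "s = s' + 3" "tail t' s'" "t' \<noteq> 1"
    using tail_minus_D[of t s] by auto
  with s show "t \<in> (\<lambda>t. 3 - 1 / t) ` (tails_upto (m - 3) - {1})"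
    by (auto simp: tails_upto_def intro!: image_eqI[of _ _ t'] exI[of _ s'])
next
  fix t assume "t \<in> (\<lambda>t. 3 - 1 / t) ` (tails_upto (m - 3) - {1})"
  then obtain t' s' where t': "t = 3 - 1 / t'" "tail t' s'" "s' \<le> m - 3" "t' \<noteq> 1"
    by (auto simp: tails_upto_def)
  with tail_ge_1[OF t'(2)] have "s' + 3 \<le> m" by auto
  with t' show "t \<in> tails_upto m \<inter> {2<..<3}"
    using tail_minus[OF t'(2,4)] tail_minus_bounds[OF t'(2,4)] by (auto simp: tails_upto_def)
qed

lemma tails_upto_shift: "tails_upto m \<inter> {3..} = (\<lambda>t. t + 2) ` tails_upto (m - 2)"
proof (intro equalityI subsetI)
  fix t assume t: "t \<in> tails_upto m \<inter> {3..}"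
  then obtain s where s: "tail t s" "s \<le> m" by (auto simp: tails_upto_def)
  with t obtain t' s' where "t = t' + 2" "s = s' + 2" "tail t' s'"
    using tail_shift_D[of t s] by auto
  with s show "t \<in> (\<lambda>t. t + 2) ` tails_upto (m - 2)"
    by (auto simp: tails_upto_def intro!: image_eqI[of _ _ t'] exI[of _ s'])
next
  fix t assume "t \<in> (\<lambda>t. t + 2) ` tails_upto (m - 2)"
  then obtain t' s' where t': "t = t' + 2" "tail t' s'" "s' \<le> m - 2"
    by (auto simp: tails_upto_def)
  with tail_ge_1[OF t'(2)] have "s' + 2 \<le> m" by auto
  with t' show "t \<in> tails_upto m \<inter> {3..}"
    using tail_shift[OF t'(2)] tail_ge_1[OF t'(2)] by (auto simp: tails_upto_def)
qed

lemma tails_upto_split: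
  "tails_upto m = (tails_upto m \<inter> {1}) \<union> (tails_upto m \<inter> {1<..2})
     \<union> (tails_upto m \<inter> {2<..<3}) \<union> (tails_upto m \<inter> {3..})"
proof (intro equalityI subsetI)
  fix t assume t: "t \<in> tails_upto m"
  then have "1 \<le> t" by (rule tails_upto_ge_1)
  then consider "t = 1" | "1 < t" "t \<le> 2" | "2 < t" "t < 3" | "3 \<le> t" by linarith
  then show "t \<in> (tails_upto m \<inter> {1}) \<union> (tails_upto m \<inter> {1<..2})
     \<union> (tails_upto m \<inter> {2<..<3}) \<union> (tails_upto m \<inter> {3..})"
    using t by cases auto
qed auto

lemma finite_tails_upto [simp]: "finite (tails_upto m)"
proof (induction m rule: less_induct)
  case (less m)
  show ?case
  proof (cases "m = 0")
    case False
    then show ?thesis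
      by (subst tails_upto_split) (simp add: tails_upto_plus tails_upto_minus tails_upto_shift less)
  qed (simp add: tails_upto_0)
qed

section \<open>Recurrence and growth of the number of tails\<close>

lemma num_tails_pos: "1 \<le> m \<Longrightarrow> 0 < num_tails m"
  unfolding num_tails_def using one_in_tails_upto[of m] by (auto simp: card_gt_0_iff)

lemma inj_on_plus: "inj_on (\<lambda>t::real. 1 + 1 / t) X"
  and inj_on_minus: "inj_on (\<lambda>t::real. 3 - 1 / t) X"
  by (auto simp: inj_on_def)

text \<open>The value 1, counted separately, makes up for the argument 1 missing from the range
  \<open>(2, 3)\<close>. That argument is present only if \<open>m \<ge> 1\<close>.\<close>

lemma num_tails_rec:
  assumes "1 \<le> m"
  shows "num_tails (m + 3) = num_tails (m + 2) + num_tails (m + 1) + num_tails m"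
proof -
  let ?V = "tails_upto (m + 3)"
  have "num_tails (m + 3)
      = card (((?V \<inter> {1}) \<union> (?V \<inter> {1<..2})) \<union> ((?V \<inter> {2<..<3}) \<union> (?V \<inter> {3..})))"
    unfolding num_tails_def by (subst tails_upto_split) (simp add: Un_assoc)
  also have "\<dots> = card (?V \<inter> {1}) + card (?V \<inter> {1<..2})
      + (card (?V \<inter> {2<..<3}) + card (?V \<inter> {3..}))"
    by (subst card_Un_disjoint, force, force, force)+ simp
  also have "card (?V \<inter> {1}) = 1" using one_in_tails_upto[of "m + 3"] by simp
  also have "card (?V \<inter> {1<..2}) = num_tails (m + 2)"
    unfolding tails_upto_plus num_tails_def by (simp add: card_image inj_on_plus)
  also have "card (?V \<inter> {2<..<3}) = num_tails m - 1"
    unfolding tails_upto_minus num_tails_def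
    using assms by (simp add: card_image inj_on_minus one_in_tails_upto)
  also have "card (?V \<inter> {3..}) = num_tails (m + 1)"
    unfolding tails_upto_shift num_tails_def by (simp add: card_image)
  finally have "num_tails (m + 3)
    = 1 + num_tails (m + 2) + ((num_tails m - 1) + num_tails (m + 1))" .
  then show ?thesis using num_tails_pos[OF assms] by simp
qed

text \<open>A linear bound suffices for divergence: the recurrence adds a positive amount in each
  step.\<close>

lemma num_tails_lower: "m \<le> num_tails (m + 3)"
proof (induction m)
  case (Suc m)
  have "num_tails (Suc m + 3) = num_tails (m + 3) + num_tails (m + 2) + num_tails (m + 1)"
    using num_tails_rec[of "Suc m"] by (simp add: numeral_eq_Suc)
  with Suc num_tails_pos[of "m + 2"] show ?case by linarith
qed simp

lemma num_tails_at_top: "filterlim (\<lambda>m. real (num_tails m)) at_top sequentially"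
proof -
  have "filterlim (\<lambda>m. real (num_tails (m + 3))) at_top sequentially"
    by (rule filterlim_at_top_mono[OF filterlim_real_sequentially]) (simp add: num_tails_lower)
  then have "filterlim (\<lambda>m. real (num_tails (Suc (Suc (Suc m))))) at_top sequentially"
    by (simp add: numeral_3_eq_3)
  then show ?thesis
    unfolding filterlim_sequentially_Suc[of "\<lambda>m. real (num_tails (Suc (Suc m)))"]
      filterlim_sequentially_Suc[of "\<lambda>m. real (num_tails (Suc m))"]
      filterlim_sequentially_Suc[of "\<lambda>m. real (num_tails m)"] .
qed

lemma num_tails_ratio_Suc: "(\<lambda>m. real (num_tails m) / real (num_tails (Suc m))) \<longlonglongrightarrow> 1 / lam"
proof -
  \<comment> \<open>Positivity and the recurrence are available only from index 1 on, hence the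
    shift.\<close>
  let ?u = "\<lambda>n. real (num_tails (Suc n))"
  have "(\<lambda>n. ?u n / ?u (Suc n)) \<longlonglongrightarrow> 1 / lam"
  proof (rule tribonacci_ratio_limit)
    show "?u (n + 3) = ?u (n + 2) + ?u (n + 1) + ?u n" for n
      using num_tails_rec[of "Suc n"] by simp
    show "0 < ?u n" for n using num_tails_pos by simp
    show "filterlim ?u at_top sequentially"
      unfolding filterlim_sequentially_Suc[of "\<lambda>m. real (num_tails m)"] by (rule num_tails_at_top)
  qed
  then show ?thesis
    unfolding filterlim_sequentially_Suc[of "\<lambda>m. real (num_tails m) / real (num_tails (Suc m))"] .
qed

text \<open>After replacing \<open>m\<close> by \<open>m + k\<close> the subtraction is exact, and
  the quotient is a product of \<open>k\<close> consecutive ratios.\<close>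

lemma num_tails_ratio: "(\<lambda>m. real (num_tails (m - k)) / real (num_tails m)) \<longlonglongrightarrow> 1 / lam ^ k"
proof (rule LIMSEQ_offset[of _ k], induction k)
  case 0
  have "\<forall>\<^sub>F m in sequentially. real (num_tails (m + 0 - 0)) / real (num_tails (m + 0)) = 1"
    using eventually_ge_at_top[of 1] by eventually_elim (use num_tails_pos in force)
  then show ?case using tendsto_eventually by simp
next
  case (Suc k)
  let ?r = "\<lambda>m. real (num_tails m) / real (num_tails (m + k))"
    and ?q = "\<lambda>m. real (num_tails m) / real (num_tails (Suc m))"
  have "(\<lambda>m. ?q m * ?r (Suc m)) \<longlonglongrightarrow> 1 / lam * (1 / lam ^ k)"
    using Suc num_tails_ratio_Suc
    by (intro tendsto_mult) (simp_all add: filterlim_sequentially_Suc[of ?r] del: add_Suc)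
  moreover have "(\<lambda>m. ?q m * ?r (Suc m)) = (\<lambda>m. real (num_tails m) / real (num_tails (m + Suc k)))"
    using num_tails_pos by (intro ext) (simp add: less_imp_neq[symmetric])
  ultimately have "(\<lambda>m. real (num_tails m) / real (num_tails (m + Suc k)))
      \<longlonglongrightarrow> 1 / lam * (1 / lam ^ k)" by (simp only:)
  then show ?case by simp
qed

section \<open>Counting tails above a threshold\<close>

lemma num_above_le: "num_above m T \<le> num_tails m"
  unfolding num_above_def num_tails_def by (auto intro: card_mono)

lemma num_above_shift:
  assumes "1 \<le> T"
  shows "num_above m (T + 2) = num_above (m - 2) T"
proof -
  have "{t \<in> tails_upto m. T + 2 < t} = {t \<in> tails_upto m \<inter> {3..}. T + 2 < t}"
    using assms by auto
  also have "\<dots> = (\<lambda>t. t + 2) ` {t \<in> tails_upto (m - 2). T < t}"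
    unfolding tails_upto_shift by auto
  finally show ?thesis by (simp add: num_above_def card_image)
qed

lemma num_above_shift_even:
  assumes "1 \<le> T"
  shows "num_above m (T + 2 * real k) = num_above (m - 2 * k) T"
proof (induction k arbitrary: m)
  case (Suc k)
  have "num_above m (T + 2 * real (Suc k)) = num_above m ((T + 2 * real k) + 2)"
    by (simp add: algebra_simps)
  also have "\<dots> = num_above (m - 2 - 2 * k) T"
    using num_above_shift[of "T + 2 * real k"] assms Suc by simp
  finally show ?case by simp
qed simp

lemma num_above_1: "\<bar>real (num_above m 1) - real (num_tails m)\<bar> \<le> 1"
proof -
  have "{t \<in> tails_upto m. 1 < t} = tails_upto m - {1}"
    using tails_upto_ge_1 by (auto simp: less_le)
  then have "num_above m 1 = num_tails m - (if 1 \<in> tails_upto m then 1 else 0)"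
    by (simp add: num_above_def num_tails_def card_Diff_singleton_if)
  then show ?thesis by auto
qed

lemma inverse_tail_iff:
  assumes "1 \<le> T" "t \<in> tails_upto m"
  shows "1 / t < 1 / T \<longleftrightarrow> T < t" "1 / t \<le> 1 / T \<longleftrightarrow> T \<le> t"
proof -
  have "0 < T" "0 < t" using assms(1) tails_upto_ge_1[OF assms(2)] by auto
  then show "1 / t < 1 / T \<longleftrightarrow> T < t" "1 / t \<le> 1 / T \<longleftrightarrow> T \<le> t"
    using inverse_less_iff_less[of t T] inverse_le_iff_le[of t T]
    unfolding inverse_eq_divide by blast+
qed

text \<open>The map \<open>3 - 1 / t\<close> preserves order, so the tails above the threshold are
  the images of those above \<open>T\<close> together with all tails in
  \<open>[3, \<infinity>)\<close>.\<close>

lemma num_above_minus: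
  assumes "1 \<le> T"
  shows "num_above m (3 - 1 / T) = num_above (m - 3) T + num_tails (m - 2)"
proof -
  let ?V = "tails_upto m"
  have T: "2 \<le> 3 - 1 / T" "3 - 1 / T < 3" using assms by (auto simp: field_simps)
  have "{t \<in> ?V. 3 - 1 / T < t} = {t \<in> ?V \<inter> {2<..<3}. 3 - 1 / T < t} \<union> (?V \<inter> {3..})"
  proof -
    have "{t \<in> ?V. c < t} = {t \<in> ?V \<inter> {2<..<3}. c < t} \<union> (?V \<inter> {3..})"
      if "2 \<le> c" "c < 3" for c using that by auto
    from this[OF T] show ?thesis .
  qed
  also have "{t \<in> ?V \<inter> {2<..<3}. 3 - 1 / T < t}
      = (\<lambda>t. 3 - 1 / t) ` {t \<in> tails_upto (m - 3). t \<noteq> 1 \<and> 1 / t < 1 / T}"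
    unfolding tails_upto_minus by auto
  \<comment> \<open>From \<open>1 \<le> T < t\<close> the condition \<open>t \<noteq> 1\<close>
    follows.\<close>
  also have "{t \<in> tails_upto (m - 3). t \<noteq> 1 \<and> 1 / t < 1 / T} = {t \<in> tails_upto (m - 3). T < t}"
    using inverse_tail_iff[OF assms] assms by auto
  also have "card ((\<lambda>t. 3 - 1 / t) ` {t \<in> tails_upto (m - 3). T < t} \<union> (?V \<inter> {3..}))
      = card ((\<lambda>t. 3 - 1 / t) ` {t \<in> tails_upto (m - 3). T < t})
      + card (?V \<inter> {3..})"
  proof (intro card_Un_disjoint)
    have "3 - 1 / t < 3" if "t \<in> tails_upto (m - 3)" for t
      using tails_upto_ge_1[OF that] by simp
    then show "(\<lambda>t. 3 - 1 / t) ` {t \<in> tails_upto (m - 3). T < t} \<inter> (?V \<inter> {3..}) = {}"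
      by fastforce
  qed auto
  finally show ?thesis
    unfolding tails_upto_shift num_above_def num_tails_def by (simp add: card_image inj_on_minus)
qed

text \<open>The map \<open>1 + 1 / t\<close> reverses order, so the complement is counted: tails in
  \<open>(1, 1 + 1 / T]\<close> come from \<open>t \<ge> T\<close>. The value 1 and a possible tail
  equal to \<open>T\<close> contribute at most 1 each to the error.\<close>

lemma num_above_plus:
  assumes "1 \<le> T"
  shows "\<bar>real (num_above m (1 + 1 / T)) - (real (num_tails m) - real (num_above (m - 1) T))\<bar> \<le> 2"
proof -
  let ?V = "tails_upto m" and ?V' = "tails_upto (m - 1)"
  have T: "1 < 1 + 1 / T" "1 + 1 / T \<le> 2" using assms by (auto simp: field_simps)
  have "{t \<in> ?V. 1 < t} = {t \<in> ?V. 1 + 1 / T < t} \<union> {t \<in> ?V \<inter> {1<..2}. t \<le> 1 + 1 / T}"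
  proof -
    have "{t \<in> ?V. 1 < t} = {t \<in> ?V. c < t} \<union> {t \<in> ?V \<inter> {1<..2}. t \<le> c}"
      if "1 < c" "c \<le> 2" for c using that by auto
    from this[OF T] show ?thesis .
  qed
  also have "card \<dots> = num_above m (1 + 1 / T) + card {t \<in> ?V \<inter> {1<..2}. t \<le> 1 + 1 / T}"
    unfolding num_above_def by (intro card_Un_disjoint) auto
  also have "{t \<in> ?V \<inter> {1<..2}. t \<le> 1 + 1 / T} = (\<lambda>t. 1 + 1 / t) ` {t \<in> ?V'. 1 / t \<le> 1 / T}"
    unfolding tails_upto_plus by auto
  also have "{t \<in> ?V'. 1 / t \<le> 1 / T} = {t \<in> ?V'. T \<le> t}"
    using inverse_tail_iff[OF assms] by auto
  also have "card ((\<lambda>t. 1 + 1 / t) ` {t \<in> ?V'. T \<le> t}) = card {t \<in> ?V'. T \<le> t}"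
    by (simp add: card_image inj_on_plus)
  also have "{t \<in> ?V'. T \<le> t} = {t \<in> ?V'. T < t} \<union> {t \<in> ?V'. t = T}"
    by auto
  also have "card ({t \<in> ?V'. T < t} \<union> {t \<in> ?V'. t = T}) = num_above (m - 1) T + card {t \<in> ?V'. t = T}"
    unfolding num_above_def by (intro card_Un_disjoint) auto
  finally have "num_above m 1
      = num_above m (1 + 1 / T) + (num_above (m - 1) T + card {t \<in> ?V'. t = T})"
    by (simp add: num_above_def)
  moreover have "card {t \<in> ?V'. t = T} \<le> card {T}" by (intro card_mono) auto
  ultimately show ?thesis using num_above_1[of m] by simp
qed

lemma num_above_odd:
  assumes "odd a"
  shows "\<bar>real (num_above m (real a)) - real (num_tails (m - (a - 1)))\<bar> \<le> 2"
proof -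
  obtain k where "a = 2 * k + 1" using assms by (elim oddE)
  then show ?thesis
    using num_above_shift_even[of 1 m k] num_above_1[of "m - 2 * k"] by (simp add: add.commute)
qed

text \<open>Shifts by two reduce the quotient to 1 or 3. The sign of the second term records whether
  the remaining map reverses (\<open>e = 1\<close>) or preserves (\<open>e = -1\<close>)
  order.\<close>

lemma num_above_step:
  fixes e :: int
  assumes "odd a" "e \<in> {1, -1}" "int a + e \<ge> 2" "1 \<le> T"
  shows "\<bar>real (num_above m (real a + of_int e / T))
    - (real (num_tails (m - (a - 1))) - of_int e * real (num_above (m - a) T))\<bar> \<le> 2"
proof -
  obtain k where k: "a = 2 * k + 1" using assms(1) by (elim oddE)
  show ?thesis
  proof (cases "e = 1")
    case True
    have "num_above m (real a + of_int e / T) = num_above (m - 2 * k) (1 + 1 / T)"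
      using num_above_shift_even[of "1 + 1 / T" m k] assms k True by (simp add: algebra_simps)
    then show ?thesis
      using num_above_plus[OF assms(4), of "m - 2 * k"] k True by simp
  next
    case False
    with assms k obtain k' where e: "e = -1" and k': "k = Suc k'" by (cases k) auto
    have "1 \<le> 3 - 1 / T" using assms by (simp add: field_simps)
    then have "num_above m (real a + of_int e / T) = num_above (m - 2 * k') (3 - 1 / T)"
      using num_above_shift_even[of "3 - 1 / T" m k'] k k' e by (simp add: algebra_simps)
    then show ?thesis
      using num_above_minus[OF assms(4), of "m - 2 * k'"] k k' e by (simp add: numeral_eq_Suc)
  qed
qed

section \<open>Asymptotic proportions\<close>

definition above_ratio :: "real \<Rightarrow> nat \<Rightarrow> real" where
  "above_ratio T m = real (num_above m T) / real (num_tails m)"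

text \<open>States that the limit superior of the deviation from \<open>S\<close> is at most
  \<open>\<delta>\<close>; this form carries error bounds through the recursion before convergence
  is known.\<close>

definition approx :: "real \<Rightarrow> real \<Rightarrow> real \<Rightarrow> bool" where
  "approx T S \<delta> \<longleftrightarrow> (\<forall>d>\<delta>. \<forall>\<^sub>F m in sequentially. \<bar>above_ratio T m - S\<bar> < d)"

lemma above_ratio_bounds: "0 \<le> above_ratio T m" "above_ratio T m \<le> 1"
  using num_above_le[of m T] by (auto simp: above_ratio_def divide_le_eq_1)

lemma approx_trivial: "approx T 0 1"
  unfolding approx_def
proof (intro allI impI always_eventually)
  fix d :: real and m assume "1 < d"
  then show "\<bar>above_ratio T m - 0\<bar> < d" using above_ratio_bounds[of T m] by linarith
qed

lemma approx_mono: "approx T S \<delta> \<Longrightarrow> \<delta> \<le> \<delta>' \<Longrightarrow> approx T S \<delta>'"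
  by (auto simp: approx_def)

lemma approx_0_iff: "approx T S 0 \<longleftrightarrow> above_ratio T \<longlonglongrightarrow> S"
  by (simp add: approx_def tendsto_iff dist_real_def)

lemma num_tails_bounded_ratio: "(\<lambda>m. C / real (num_tails m)) \<longlonglongrightarrow> 0"
  by (rule tendsto_divide_0[OF tendsto_const filterlim_at_top_imp_at_infinity[OF num_tails_at_top]])

lemma approx_odd:
  assumes "odd a"
  shows "approx (real a) (1 / lam ^ (a - 1)) 0"
proof -
  have "(\<lambda>m. above_ratio (real a) m - real (num_tails (m - (a - 1))) / real (num_tails m)) \<longlonglongrightarrow> 0"
  proof (rule tendsto_0_le[where K = 1, OF num_tails_bounded_ratio[of 2]], intro always_eventually allI)
    fix m
    have "above_ratio (real a) m - real (num_tails (m - (a - 1))) / real (num_tails m)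
        = (real (num_above m (real a)) - real (num_tails (m - (a - 1)))) / real (num_tails m)"
      by (simp add: above_ratio_def diff_divide_distrib)
    then show "norm (above_ratio (real a) m - real (num_tails (m - (a - 1))) / real (num_tails m))
        \<le> norm (2 / real (num_tails m)) * 1"
      using num_above_odd[OF assms, of m] by (simp add: divide_right_mono)
  qed
  from tendsto_add[OF this num_tails_ratio[of "a - 1"]] show ?thesis
    by (simp add: approx_0_iff)
qed

text \<open>Dividing \<open>num_above_step\<close> by \<open>num_tails m\<close> turns the shifts of
  the index into powers of \<open>1 / lam\<close>, so an error in the ratio for \<open>T\<close> is
  contracted by \<open>1 / lam ^ a\<close>.\<close>

lemma approx_step:
  fixes e :: int
  assumes a: "odd a" "e \<in> {1, -1}" "int a + e \<ge> 2" "1 \<le> T" and S: "approx T S \<delta>"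
  shows "approx (real a + of_int e / T) (1 / lam ^ (a - 1) - of_int e / lam ^ a * S) (\<delta> / lam ^ a)"
  unfolding approx_def
proof (intro allI impI)
  fix d assume d: "\<delta> / lam ^ a < d"
  define q where "q k m = real (num_tails (m - k)) / real (num_tails m)" for k m
  \<comment> \<open>Collects the errors that vanish: the bounded counting error and the deviations
    of the two ratios from their limits.\<close>
  define z where "z m = 2 / real (num_tails m) + \<bar>q (a - 1) m - 1 / lam ^ (a - 1)\<bar>
    + \<bar>q a m - 1 / lam ^ a\<bar>" for m
  have la: "0 < lam ^ a" using lam_bounds by simp
  have "q k \<longlonglongrightarrow> 1 / lam ^ k" for k unfolding q_def by (rule num_tails_ratio)
  then have "z \<longlonglongrightarrow> 0 + \<bar>1 / lam ^ (a - 1) - 1 / lam ^ (a - 1)\<bar> + \<bar>1 / lam ^ a - 1 / lam ^ a\<bar>"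
    unfolding z_def by (intro tendsto_intros num_tails_bounded_ratio)
  then have z: "z \<longlonglongrightarrow> 0" by simp
  \<comment> \<open>The midpoint of \<open>\<delta>\<close> and \<open>d * lam ^ a\<close>, leaving
    room below \<open>d\<close> for \<open>z m\<close>.\<close>
  define d' where "d' = (d * lam ^ a + \<delta>) / 2"
  have d': "\<delta> < d'" "d' / lam ^ a < d" using d la by (auto simp: d'_def field_simps)
  have "\<forall>\<^sub>F m in sequentially. \<bar>above_ratio T m - S\<bar> < d'"
    using S d'(1) by (auto simp: approx_def)
  then have "\<forall>\<^sub>F m in sequentially. \<bar>above_ratio T (m - a) - S\<bar> < d'"
    using eventually_compose_filterlim[OF _ filterlim_minus_const_nat_at_top[of a]] by blast
  moreover have "\<forall>\<^sub>F m in sequentially. z m < d - d' / lam ^ a"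
    using order_tendstoD(2)[OF z] d'(2) by simp
  ultimately show "\<forall>\<^sub>F m in sequentially.
    \<bar>above_ratio (real a + of_int e / T) m - (1 / lam ^ (a - 1) - of_int e / lam ^ a * S)\<bar> < d"
    using eventually_gt_at_top[of a]
  proof eventually_elim
    case (elim m)
    define r where "r = above_ratio T (m - a)"
    let ?N = "real (num_tails m)" and ?e = "real_of_int e"
    have r: "0 \<le> r" "r \<le> 1" "\<bar>r - S\<bar> < d'" using above_ratio_bounds elim by (auto simp: r_def)
    have abs_e: "\<bar>?e\<bar> = 1" using a(2) by auto
    \<comment> \<open>Positivity allows the factor \<open>num_tails (m - a)\<close> to cancel in
      \<open>q a m * r\<close>.\<close>
    have "0 < num_tails (m - a)" using elim num_tails_pos by simp
    then have "above_ratio (real a + ?e / T) m - (q (a - 1) m - ?e * (q a m * r))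
      = (real (num_above m (real a + ?e / T))
        - (real (num_tails (m - (a - 1))) - ?e * real (num_above (m - a) T))) / ?N"
      by (simp add: above_ratio_def q_def r_def diff_divide_distrib)
    then have 1: "\<bar>above_ratio (real a + ?e / T) m - (q (a - 1) m - ?e * (q a m * r))\<bar> \<le> 2 / ?N"
      using num_above_step[OF a, of m] by (simp add: divide_right_mono)
    \<comment> \<open>The first part is controlled because \<open>r\<close> lies in
      \<open>[0, 1]\<close>; the second is the earlier error scaled by
      \<open>1 / lam ^ a\<close>.\<close>
    have "q a m * r - 1 / lam ^ a * S = (q a m - 1 / lam ^ a) * r + (r - S) / lam ^ a"
      by (simp add: algebra_simps diff_divide_distrib)
    also have "\<bar>\<dots>\<bar> \<le> \<bar>q a m - 1 / lam ^ a\<bar> * r + \<bar>r - S\<bar> / lam ^ a"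
      using r la abs_triangle_ineq[of "(q a m - 1 / lam ^ a) * r" "(r - S) / lam ^ a"]
      by (simp add: abs_mult)
    also have "\<bar>q a m - 1 / lam ^ a\<bar> * r \<le> \<bar>q a m - 1 / lam ^ a\<bar>"
      using r by (simp add: mult_left_le)
    also have "\<bar>r - S\<bar> / lam ^ a < d' / lam ^ a"
      using r la by (simp add: divide_strict_right_mono)
    finally have "\<bar>q a m * r - 1 / lam ^ a * S\<bar> < \<bar>q a m - 1 / lam ^ a\<bar> + d' / lam ^ a" by simp
    moreover have "\<bar>?e * (q a m * r) - ?e / lam ^ a * S\<bar> = \<bar>q a m * r - 1 / lam ^ a * S\<bar>"
      using abs_mult[of ?e "q a m * r - 1 / lam ^ a * S"] abs_e by (simp add: algebra_simps)
    ultimately show ?case using 1 elim(2) unfolding z_def by linarith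
  qed
qed

text \<open>Horner form of the partial sums of the series, started at the digit with index \<open>j\<close>.\<close>

primrec tail_sum :: "(nat \<Rightarrow> int) \<Rightarrow> (nat \<Rightarrow> nat) \<Rightarrow> nat \<Rightarrow> nat \<Rightarrow> real" where
  "tail_sum e a j 0 = 0"
| "tail_sum e a j (Suc n)
    = 1 / lam ^ (a j - 1) - of_int (e (Suc j)) / lam ^ a j * tail_sum e a (Suc j) n"

text \<open>At the last quotient the limit is exact by \<open>approx_odd\<close>, and contraction
  keeps the error at 0.\<close>

lemma approx_finite:
  assumes "odd_cf_digits (enat (j + m)) e a" "1 \<le> j"
  shows "approx (real (a j) + cf_frac e a (Suc j) m) (tail_sum e a j (Suc m)) 0"
  using assms
proof (induction m arbitrary: j)
  case 0
  then show ?case using odd_cf_digitsD[OF 0(1), of j] approx_odd by auto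
next
  case (Suc m)
  have dig: "odd_cf_digits (enat (Suc j + m)) e a" using Suc.prems by simp
  have "1 \<le> real (a (Suc j)) + cf_frac e a (Suc (Suc j)) m"
    using tail_of_digits[OF dig] tail_ge_1 by auto
  moreover have "odd (a j)" using odd_cf_digitsD[OF Suc.prems(1), of j] Suc.prems by auto
  moreover have "e (Suc j) \<in> {1, -1}" using odd_cf_digitsD(2)[OF Suc.prems(1), of "Suc j"] by auto
  moreover have "2 \<le> int (a j) + e (Suc j)"
    using odd_cf_digits_stepD[OF Suc.prems(1), of j] Suc.prems by auto
  ultimately show ?case
    using approx_step[OF _ _ _ _ Suc.IH[OF dig]] by simp
qed

text \<open>Starting from the trivial error 1, every digit contracts the error by at least the
  factor \<open>1 / lam\<close>, since \<open>a j \<ge> 1\<close>.\<close>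

lemma approx_infinite:
  assumes dig: "odd_cf_digits \<infinity> e a"
    and T: "\<And>j. 1 \<le> j \<Longrightarrow> 1 \<le> T j \<and> T j = real (a j) + of_int (e (Suc j)) / T (Suc j)"
    and j: "1 \<le> j"
  shows "approx (T j) (tail_sum e a j n) (1 / lam ^ n)"
  using j
proof (induction n arbitrary: j)
  case 0
  then show ?case using approx_trivial by simp
next
  case (Suc n)
  have a: "odd (a j)" "e (Suc j) \<in> {1, -1}" "2 \<le> int (a j) + e (Suc j)" "1 \<le> a j"
    using odd_cf_digitsD[OF dig, of j] odd_cf_digitsD[OF dig, of "Suc j"]
      odd_cf_digits_stepD[OF dig, of j] Suc.prems by auto
  have "approx (T j) (tail_sum e a j (Suc n)) (1 / lam ^ n / lam ^ a j)"
    using approx_step[OF a(1-3) _ Suc.IH[of "Suc j"]] T[of j] T[of "Suc j"] Suc.prems by simp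
  moreover have "1 / lam ^ n / lam ^ a j \<le> 1 / lam ^ Suc n"
    using lam_bounds a(4) power_increasing[of 1 "a j" lam] by (simp add: field_simps)
  ultimately show ?case using approx_mono by blast
qed

text \<open>Unrolls the Horner form. The start \<open>k\<close> must vary in the induction, and the
  prefactor contains the sign with index \<open>Suc k\<close>, which \<open>tail_sum\<close> leaves
  out.\<close>

lemma tail_sum_eq:
  assumes dig: "odd_cf_digits l e a" and "enat (k + n) \<le> l"
  shows "(\<Sum>i=1..k+n. of_int (E e i) / lam ^ A a i) = (\<Sum>i=1..k. of_int (E e i) / lam ^ A a i)
    + of_int (E e (Suc k)) / lam ^ (\<Sum>j=1..k. a j) * tail_sum e a (Suc k) n"
  using assms(2)
proof (induction n arbitrary: k)
  case (Suc n)
  let ?t = "\<lambda>i. of_int (E e i) / lam ^ A a i :: real"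
  have l: "enat (Suc k) \<le> l" using Suc.prems by (rule order_trans[rotated]) simp
  have "1 \<le> a (Suc k)" using odd_cf_digitsD[OF dig _ l] by simp
  \<comment> \<open>The subtraction of 1 in \<open>A\<close> can be moved onto the newest quotient
    because that quotient is positive.\<close>
  then have "A a (Suc k) = (\<Sum>j=1..k. a j) + (a (Suc k) - 1)" by (simp add: A_def)
  then have t: "?t (Suc k) = of_int (E e (Suc k)) / lam ^ (\<Sum>j=1..k. a j) * (1 / lam ^ (a (Suc k) - 1))"
    by (simp add: power_add)
  have "(\<Sum>i=1..k+Suc n. ?t i) = (\<Sum>i=1..Suc k+n. ?t i)" by simp
  also have "\<dots> = (\<Sum>i=1..k. ?t i) + ?t (Suc k)
     + of_int (E e (Suc (Suc k))) / lam ^ (\<Sum>j=1..Suc k. a j) * tail_sum e a (Suc (Suc k)) n"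
    using Suc.IH[of "Suc k"] Suc.prems by simp
  also have "E e (Suc (Suc k)) = - e (Suc (Suc k)) * E e (Suc k)" by (simp add: E_def)
  also have "lam ^ (\<Sum>j=1..Suc k. a j) = lam ^ (\<Sum>j=1..k. a j) * lam ^ a (Suc k)"
    by (simp add: power_add)
  finally show ?case
    unfolding t by (simp add: right_diff_distrib mult.commute mult.left_commute del: sum.cl_ivl_Suc)
qed simp

lemma tail_sum_1:
  assumes "odd_cf_digits l e a" "enat n \<le> l" "1 \<le> l"
  shows "tail_sum e a 1 n = (\<Sum>i=1..n. of_int (E e i) / lam ^ A a i)"
  using tail_sum_eq[OF assms(1), of 0 n] assms(2) odd_cf_digits_firstD[OF assms(1,3)]
  by (simp add: E_def)

section \<open>The distribution function\<close>

text \<open>The substitution \<open>t = 1 / (1 - x)\<close> covers every point except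
  \<open>x = 1\<close>, which is added by hand.\<close>

lemma M_eq: "M n = insert 1 ((\<lambda>t. 1 - 1 / t) ` tails_upto (n + 1))"
proof (intro equalityI subsetI)
  fix x assume x: "x \<in> M n"
  show "x \<in> insert 1 ((\<lambda>t. 1 - 1 / t) ` tails_upto (n + 1))"
  proof (cases "x = 1")
    case False
    define t where "t = 1 / (1 - x)"
    have "t \<in> \<rat>" using x by (auto simp: M_def t_def)
    moreover have "1 \<le> t" using x False by (auto simp: M_def t_def field_simps)
    ultimately obtain s where s: "tail t s" using tail_exists by blast
    have "x = 1 - 1 / t" by (simp add: t_def)
    moreover have "s \<le> n + 1" using x digit_sum_tail[OF s] \<open>x = 1 - 1 / t\<close> by (simp add: M_def)
    ultimately show ?thesis using s by (auto simp: tails_upto_def)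
  qed simp
next
  fix x assume "x \<in> insert 1 ((\<lambda>t. 1 - 1 / t) ` tails_upto (n + 1))"
  then show "x \<in> M n"
  proof (elim insertE imageE)
    assume "x = 1" then show ?thesis by (simp add: M_def digit_sum_1)
  next
    fix t assume x: "x = 1 - 1 / t" and "t \<in> tails_upto (n + 1)"
    then obtain s where s: "tail t s" "s \<le> n + 1" by (auto simp: tails_upto_def)
    then show ?thesis
      using tail_ge_1[OF s(1)] tail_Rats[OF s(1)] digit_sum_tail[OF s(1)] x by (auto simp: M_def)
  qed
qed

lemma inj_on_one_minus_inverse: "inj_on (\<lambda>t::real. 1 - 1 / t) X"
  by (auto simp: inj_on_def)

lemma card_M: "card (M n) = num_tails (n + 1) + 1"
proof -
  have "1 \<notin> (\<lambda>t. 1 - 1 / t) ` tails_upto (n + 1)" using tails_upto_ge_1 by fastforce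
  then show ?thesis
    by (simp add: M_eq num_tails_def card_image inj_on_one_minus_inverse)
qed

lemma F_seq_1: "F_seq n 1 = 1"
proof -
  have "{\<xi> \<in> M n. \<xi> \<le> 1} = M n" by (auto simp: M_def)
  then show ?thesis by (simp add: F_seq_def card_M)
qed

text \<open>Since \<open>1 - 1 / t\<close> increases with \<open>t\<close>, points up to
  \<open>1 - 1 / T\<close> correspond to tails up to \<open>T\<close>; the extra point 1 lies above
  the threshold.\<close>

lemma card_M_le:
  assumes "1 \<le> T"
  shows "card {\<xi> \<in> M n. \<xi> \<le> 1 - 1 / T} + num_above (n + 1) T = num_tails (n + 1)"
proof -
  let ?V = "tails_upto (n + 1)"
  have "{\<xi> \<in> M n. \<xi> \<le> 1 - 1 / T} = (\<lambda>t. 1 - 1 / t) ` {t \<in> ?V. t \<le> T}"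
  proof -
    have "{\<xi> \<in> M n. \<xi> \<le> 1 - 1 / T} = (\<lambda>t. 1 - 1 / t) ` {t \<in> ?V. 1 / T \<le> 1 / t}"
      unfolding M_eq using assms by auto
    also have "{t \<in> ?V. 1 / T \<le> 1 / t} = {t \<in> ?V. t \<le> T}"
      using inverse_tail_iff(1)[OF assms] by (auto simp flip: not_less)
    finally show ?thesis .
  qed
  then have "card {\<xi> \<in> M n. \<xi> \<le> 1 - 1 / T} = card {t \<in> ?V. t \<le> T}"
    by (simp add: card_image inj_on_one_minus_inverse)
  moreover have "card {t \<in> ?V. t \<le> T} + num_above (n + 1) T = card ({t \<in> ?V. t \<le> T} \<union> {t \<in> ?V. T < t})"
    unfolding num_above_def by (intro card_Un_disjoint[symmetric]) auto
  moreover have "{t \<in> ?V. t \<le> T} \<union> {t \<in> ?V. T < t} = ?V" by auto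
  ultimately show ?thesis by (simp add: num_tails_def)
qed

lemma F_seq_limit:
  assumes "1 \<le> T" and lim: "above_ratio T \<longlonglongrightarrow> S"
  shows "(\<lambda>n. F_seq n (1 - 1 / T)) \<longlonglongrightarrow> 1 - S"
proof -
  let ?N = "\<lambda>n. real (num_tails (Suc n))"
  \<comment> \<open>Separates the effect of the extra point 1 in \<open>M n\<close> as a factor
    tending to 1.\<close>
  have frac: "(N - P) / (N + 1) = (1 - P / N) * (1 - 1 / (N + 1))" if "0 < N" for N P :: real
  proof -
    have "1 - P / N = (N - P) / N" "1 - 1 / (N + 1) = N / (N + 1)"
      using that by (simp_all add: field_simps)
    then show ?thesis using that by simp
  qed
  have F: "F_seq n (1 - 1 / T) = (1 - above_ratio T (Suc n)) * (1 - 1 / (?N n + 1))" for n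
  proof -
    have "real (card {\<xi> \<in> M n. \<xi> \<le> 1 - 1 / T}) = ?N n - real (num_above (Suc n) T)"
      using card_M_le[OF assms(1), of n] by simp
    then have "F_seq n (1 - 1 / T) = (?N n - real (num_above (Suc n) T)) / (?N n + 1)"
      unfolding F_seq_def card_M by simp
    then show ?thesis
      using frac[of "?N n"] num_tails_pos[of "Suc n"] by (simp add: above_ratio_def)
  qed
  have "filterlim (\<lambda>n. ?N n + 1) at_top sequentially"
  proof (rule filterlim_at_top_mono)
    show "filterlim ?N at_top sequentially"
      unfolding filterlim_sequentially_Suc[of "\<lambda>m. real (num_tails m)"] by (rule num_tails_at_top)
  qed simp
  then have "(\<lambda>n. 1 / (?N n + 1)) \<longlonglongrightarrow> 0"
    by (intro tendsto_divide_0[OF tendsto_const] filterlim_at_top_imp_at_infinity)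
  moreover have "(\<lambda>n. above_ratio T (Suc n)) \<longlonglongrightarrow> S"
    using lim by (simp add: filterlim_sequentially_Suc)
  ultimately have "(\<lambda>n. (1 - above_ratio T (Suc n)) * (1 - 1 / (?N n + 1))) \<longlonglongrightarrow> (1 - S) * (1 - 0)"
    by (intro tendsto_intros)
  then show ?thesis by (simp add: F)
qed

text \<open>A truncation of an infinite expansion may violate the condition on the last quotient, so
  \<open>tail_of_digits\<close> does not apply and the bound is proved directly.\<close>

lemma truncated_tail_ge_1:
  assumes "odd_cf_digits \<infinity> e a" "1 \<le> j"
  shows "1 \<le> real (a j) + cf_frac e a (Suc j) m"
  using assms(2)
proof (induction m arbitrary: j)
  case 0
  then show ?case using odd_cf_digitsD(3)[OF assms(1), of j] by simp
next
  case (Suc m)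
  then show ?case
    using odd_cf_digitsD[OF assms(1), of j] odd_cf_digitsD(2)[OF assms(1), of "Suc j"]
      odd_cf_digits_stepD[OF assms(1), of j]
      step_gt_1[of "a j" "e (Suc j)" "real (a (Suc j)) + cf_frac e a (Suc (Suc j)) m"]
      Suc.IH[of "Suc j"] by simp
qed

text \<open>Only the whole fraction is known to converge. Solving each level for the next
  denominator passes convergence down; the irrationality of every limit keeps it different from
  \<open>a j\<close>, so the divisor does not tend to 0.\<close>

lemma tails_converge:
  assumes dig: "odd_cf_digits \<infinity> e a" and lim: "convergent_cf e a \<longlonglongrightarrow> x" and irr: "x \<notin> \<rat>"
  shows "\<exists>T. (\<forall>j\<ge>1. 1 \<le> T j \<and> T j = real (a j) + of_int (e (Suc j)) / T (Suc j)) \<and> x = 1 - 1 / T 1"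
proof -
  define D where "D j m = real (a j) + cf_frac e a (Suc j) m" for j m
  have D1: "1 \<le> D j m" if "1 \<le> j" for j m
    unfolding D_def by (rule truncated_tail_ge_1[OF dig that])
  have conv: "convergent_cf e a (Suc m) = 1 - 1 / D 1 m" for m
    using convergent_cf_Suc[OF dig, of m] by (simp add: D_def numeral_2_eq_2)
  have D_Suc: "D j (Suc m) = real (a j) + of_int (e (Suc j)) / D (Suc j) m" for j m
    by (simp add: D_def)
  have "\<exists>t. t \<notin> \<rat> \<and> D j \<longlonglongrightarrow> t" if "1 \<le> j" for j
    using that
  proof (induction j rule: dec_induct)
    case base
    have "x \<noteq> 1" using irr by auto
    have "(\<lambda>m. convergent_cf e a (Suc m)) \<longlonglongrightarrow> x" using lim by (rule LIMSEQ_Suc)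
    then have "(\<lambda>m. 1 / (1 - convergent_cf e a (Suc m))) \<longlonglongrightarrow> 1 / (1 - x)"
      using \<open>x \<noteq> 1\<close> by (intro tendsto_intros) auto
    moreover have "1 / (1 - convergent_cf e a (Suc m)) = D 1 m" for m by (simp add: conv)
    ultimately have "D 1 \<longlonglongrightarrow> 1 / (1 - x)" by simp
    moreover have "1 / (1 - x) \<notin> \<rat>"
    proof
      assume "1 / (1 - x) \<in> \<rat>"
      then have "1 - 1 / (1 / (1 - x)) \<in> \<rat>" by (rule Rats_diff[OF Rats_1 Rats_divide[OF Rats_1]])
      with irr show False by simp
    qed
    ultimately show ?case by blast
  next
    case (step j)
    then obtain t where t: "t \<notin> \<rat>" "D j \<longlonglongrightarrow> t" by blast
    let ?e = "real_of_int (e (Suc j))"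
    have e: "?e \<noteq> 0" using odd_cf_digitsD(2)[OF dig, of "Suc j"] by auto
    have "t \<noteq> real (a j)" using t by auto
    have "(\<lambda>m. D j (Suc m)) \<longlonglongrightarrow> t" using t(2) by (rule LIMSEQ_Suc)
    then have "(\<lambda>m. ?e / (D j (Suc m) - real (a j))) \<longlonglongrightarrow> ?e / (t - real (a j))"
      using \<open>t \<noteq> real (a j)\<close> by (intro tendsto_intros) auto
    moreover have "?e / (D j (Suc m) - real (a j)) = D (Suc j) m" for m
      using e by (simp add: D_Suc)
    ultimately have "D (Suc j) \<longlonglongrightarrow> ?e / (t - real (a j))" by simp
    moreover have "?e / (t - real (a j)) \<notin> \<rat>"
    proof
      assume "?e / (t - real (a j)) \<in> \<rat>"
      then have "real (a j) + ?e / (?e / (t - real (a j))) \<in> \<rat>"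
        by (rule Rats_add[OF Rats_of_nat Rats_divide[OF Rats_of_int]])
      with t(1) e show False by simp
    qed
    ultimately show ?case by blast
  qed
  then obtain T where T: "\<And>j. 1 \<le> j \<Longrightarrow> D j \<longlonglongrightarrow> T j" by metis
  have T1: "1 \<le> T j" if "1 \<le> j" for j
    using D1[OF that] by (intro LIMSEQ_le_const[OF T[OF that]]) auto
  have "T j = real (a j) + of_int (e (Suc j)) / T (Suc j)" if "1 \<le> j" for j
  proof (rule LIMSEQ_unique[OF LIMSEQ_Suc[OF T[OF that]]])
    show "(\<lambda>m. D j (Suc m)) \<longlonglongrightarrow> real (a j) + of_int (e (Suc j)) / T (Suc j)"
      unfolding D_Suc using T[of "Suc j"] T1[of "Suc j"] by (intro tendsto_intros) auto
  qed
  moreover have "x = 1 - 1 / T 1"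
  proof (rule LIMSEQ_unique[OF LIMSEQ_Suc[OF lim]])
    show "(\<lambda>m. convergent_cf e a (Suc m)) \<longlonglongrightarrow> 1 - 1 / T 1"
      unfolding conv using T[of 1] T1[of 1] by (intro tendsto_intros) auto
  qed
  ultimately show ?thesis using T1 by blast
qed

text \<open>Quotients are at least 1, so the exponent \<open>A a (Suc i)\<close> is at least
  \<open>i\<close> and a geometric series dominates.\<close>

lemma series_summable:
  assumes dig: "odd_cf_digits \<infinity> e a"
  shows "summable (\<lambda>i. of_int (E e (Suc i)) / lam ^ A a (Suc i))"
proof (rule summable_comparison_test')
  show "summable (\<lambda>i. (1 / lam) ^ i)"
    using lam_bounds by (intro summable_geometric) simp
  fix i :: nat assume "0 \<le> i"
  have "real (card {1..Suc i}) \<le> (\<Sum>j=1..Suc i. real (a j))"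
    using odd_cf_digitsD(3)[OF dig] sum_mono[of "{1..Suc i}" "\<lambda>_. 1" "\<lambda>j. real (a j)"] by simp
  then have "i \<le> A a (Suc i)" by (simp add: A_def del: sum.cl_ivl_Suc flip: of_nat_sum)
  then have "lam ^ i \<le> lam ^ A a (Suc i)" using lam_bounds by (intro power_increasing) auto
  moreover have "\<bar>E e k\<bar> = 1" for k
  proof (induction k)
    case (Suc k)
    then show ?case using odd_cf_digitsD(2)[OF dig, of "Suc k"] by (auto simp: E_def abs_mult)
  qed (simp add: E_def)
  then have "\<bar>real_of_int (E e (Suc i))\<bar> = 1" by (metis of_int_1 of_int_abs)
  ultimately show "norm (of_int (E e (Suc i)) / lam ^ A a (Suc i)) \<le> (1 / lam) ^ i"
    using lam_bounds by (simp add: power_divide frac_le)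
qed

theorem theorem1:
  fixes x :: real and l :: enat and e :: "nat \<Rightarrow> int" and a :: "nat \<Rightarrow> nat"
  assumes "x \<in> {0..1}"
    and "odd_cf_rep x l e a"
  shows "case l of
      enat k \<Rightarrow> (\<lambda>n. F_seq n x) \<longlonglongrightarrow> 1 - (\<Sum>i=1..k. of_int (E e i) / lam ^ A a i)
    | \<infinity> \<Rightarrow> (\<exists>s. (\<lambda>i. of_int (E e (Suc i)) / lam ^ A a (Suc i)) sums s
               \<and> (\<lambda>n. F_seq n x) \<longlonglongrightarrow> 1 - s)"
proof (cases l)
  case (enat k)
  have dig: "odd_cf_digits (enat k) e a" and x: "x = convergent_cf e a k"
    using assms(2) enat by (auto simp: odd_cf_rep_def cf_has_value_def)
  show ?thesis
  proof (cases k)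
    case 0
    then show ?thesis using enat x by (simp add: convergent_cf_def F_seq_1)
  next
    case (Suc m)
    let ?T = "real (a 1) + cf_frac e a 2 m"
    have dig1: "odd_cf_digits (enat (1 + m)) e a" using dig Suc by simp
    have l1: "1 \<le> enat k" using Suc by (simp add: one_enat_def)
    have "1 \<le> ?T" using tail_of_digits[OF dig1] tail_ge_1 by (auto simp: numeral_2_eq_2)
    moreover have "above_ratio ?T \<longlonglongrightarrow> tail_sum e a 1 k"
      using approx_finite[OF dig1] Suc
      by (simp add: approx_0_iff numeral_2_eq_2 del: tail_sum.simps)
    moreover have "x = 1 - 1 / ?T" using convergent_cf_Suc[OF dig l1] x Suc by simp
    ultimately show ?thesis
      using F_seq_limit tail_sum_1[OF dig order_refl l1] enat by simp
  qed
next
  case infinity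
  have dig: "odd_cf_digits \<infinity> e a" and lim: "convergent_cf e a \<longlonglongrightarrow> x" and irr: "x \<notin> \<rat>"
    using assms(2) infinity by (auto simp: odd_cf_rep_def cf_has_value_def)
  obtain T where T: "\<And>j. 1 \<le> j \<Longrightarrow> 1 \<le> T j \<and> T j = real (a j) + of_int (e (Suc j)) / T (Suc j)"
    and x: "x = 1 - 1 / T 1"
    using tails_converge[OF dig lim irr] by blast
  let ?f = "\<lambda>i. of_int (E e (Suc i)) / lam ^ A a (Suc i) :: real"
  obtain s where s: "?f sums s" using series_summable[OF dig] by (auto simp: summable_def)
  have "tail_sum e a 1 = (\<lambda>n. \<Sum>i<n. ?f i)"
    using tail_sum_1[OF dig] by (intro ext) (simp add: sum.atLeast1_atMost_eq)
  then have S: "tail_sum e a 1 \<longlonglongrightarrow> s" using s unfolding sums_def by metis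
  have pow: "(\<lambda>n. 1 / lam ^ n) \<longlonglongrightarrow> 0"
    using LIMSEQ_power_zero[of "1 / lam"] lam_bounds by (simp add: power_divide)
  have "approx (T 1) s 0"
    unfolding approx_def
  proof (intro allI impI)
    fix d :: real assume "0 < d"
    then have "0 < d / 2" by simp
    \<comment> \<open>A single \<open>n\<close> is chosen for which the rest of the series and the
      bound from \<open>approx_infinite\<close> both lie below \<open>d / 2\<close>.\<close>
    then have "\<forall>\<^sub>F n in sequentially. dist (tail_sum e a 1 n) s < d / 2 \<and> 1 / lam ^ n < d / 2"
      by (intro eventually_conj tendstoD[OF S] order_tendstoD(2)[OF pow])
    then obtain n where n: "\<bar>tail_sum e a 1 n - s\<bar> < d / 2" "1 / lam ^ n < d / 2"
      by (auto simp: eventually_sequentially dist_real_def)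
    have "\<forall>\<^sub>F m in sequentially. \<bar>above_ratio (T 1) m - tail_sum e a 1 n\<bar> < d / 2"
      using approx_infinite[OF dig T, of 1 n] n(2) unfolding approx_def by blast
    then show "\<forall>\<^sub>F m in sequentially. \<bar>above_ratio (T 1) m - s\<bar> < d"
      by eventually_elim (use n(1) in linarith)
  qed
  then have "(\<lambda>n. F_seq n x) \<longlonglongrightarrow> 1 - s"
    using F_seq_limit[of "T 1" s] T[of 1] x by (simp add: approx_0_iff)
  with s infinity show ?thesis by auto
qed

end
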